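(* Let $F:\mathbb{R}^d\to\mathbb{R}^d$ be $L$-Lipschitz continuous ($L>0$) and suppose that $u^*\in\mathbb{R}^d$ is a weak Minty solution for $F$ with parameter $\rho>0$, where $\rho<\frac1L$. Let $(u_k)_{k\ge 0}$ be the iterates generated by OGDA$+$ with starting point $u_0=u_{-1}\in\mathbb{R}^d$, parameter $0<\gamma\le 1$ and step size $a>0$ satisfying $a>\rho$ and $$aL\le\frac{1-\gamma}{1+\gamma}.$$ Then, for all $k\ge 1$, $$\min_{i=0,\dots,k-1}\Vert F(u_i)\Vert^2\le\frac{1}{k\,a\,\gamma\,(a-\rho)}\,\Vert u_0+aF(u_0)-u^*\Vert^2 .$$ In particular, as long as $\rho<\frac1L$, one can find $\gamma\in(0,1]$ small enough (together with a step size $a$) such that the conditions $a>\rho$ and $aL\le\frac{1-\gamma}{1+\gamma}$ are satisfied and hence the bound $\min_{i=0,\dots,k-1}\Vert F(u_i)\Vert^2\le\frac{1}{k\,a\,\gamma\,(a-\rho)}\,\Vert u_0+aF(u_0)-u^*\Vert^2$ holds for all $k\ge1$.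
   Context: $\langle\cdot,\cdot\rangle$ and $\Vert\cdot\Vert$ are the Euclidean inner product and norm on $\mathbb{R}^d$. Weak Minty solution: given $F:\mathbb{R}^d\to\mathbb{R}^d$, a point $u^*\in\mathbb{R}^d$ is a weak Minty solution with parameter $\rho>0$ if $\langle F(u),u-u^*\rangle\ge-\frac{\rho}{2}\Vert F(u)\Vert^2$ for all $u\in\mathbb{R}^d$. OGDA$+$: given a starting point $u_0=u_{-1}\in\mathbb{R}^d$, a step size $a>0$ and a parameter $0<\gamma\le1$, for $k=0,1,\dots$ set $u_{k+1}=u_k-a\big((1+\gamma)F(u_k)-F(u_{k-1})\big)$. *)

theory Defs
  imports "HOL-Analysis.Analysis"
begin

definition weak_minty_solution :: "(real ^ 'd \<Rightarrow> real ^ 'd) \<Rightarrow> real \<Rightarrow> real ^ 'd \<Rightarrow> bool" where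
  "weak_minty_solution F \<rho> ustar \<longleftrightarrow>
     (\<forall>u. F u \<bullet> (u - ustar) \<ge> - (\<rho> / 2) * (norm (F u))\<^sup>2)"

text \<open>
  The convention \<open>u\<^sub>-\<^sub>1 = u\<^sub>0\<close> is obtained from truncated subtraction: for \<open>k = 0\<close>
  the index \<open>k - 1\<close> is \<open>0\<close>.
\<close>

fun ogda_plus :: "(real ^ 'd \<Rightarrow> real ^ 'd) \<Rightarrow> real \<Rightarrow> real \<Rightarrow> real ^ 'd \<Rightarrow> nat \<Rightarrow> real ^ 'd" where
  "ogda_plus F a \<gamma> u0 0 = u0"
| "ogda_plus F a \<gamma> u0 (Suc k) =
     ogda_plus F a \<gamma> u0 k
       - a *\<^sub>R ((1 + \<gamma>) *\<^sub>R F (ogda_plus F a \<gamma> u0 k) - F (ogda_plus F a \<gamma> u0 (k - 1)))"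

end

theory Submission
  imports Defs
begin

text \<open>
  Put \<open>g\<^sub>k = F u\<^sub>k\<close> and \<open>v\<^sub>k = u\<^sub>k + a g\<^sub>k\<^sub>-\<^sub>1\<close>, so that \<open>v\<^sub>k\<^sub>+\<^sub>1 = v\<^sub>k - a \<gamma> g\<^sub>k\<close>. Expanding the square and
  using the weak Minty inequality,
  \<open>\<parallel>v\<^sub>k\<^sub>+\<^sub>1 - u*\<parallel>\<^sup>2 - \<parallel>v\<^sub>k - u*\<parallel>\<^sup>2 \<le> a \<gamma> (\<rho> - a + a \<gamma>) \<parallel>g\<^sub>k\<parallel>\<^sup>2 + a\<^sup>2 \<gamma> (\<parallel>g\<^sub>k - g\<^sub>k\<^sub>-\<^sub>1\<parallel>\<^sup>2 - \<parallel>g\<^sub>k\<^sub>-\<^sub>1\<parallel>\<^sup>2)\<close>.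
  By the Lipschitz condition \<open>\<parallel>g\<^sub>k\<^sub>+\<^sub>1 - g\<^sub>k\<parallel> \<le> a L \<parallel>(1 + \<gamma>) g\<^sub>k - g\<^sub>k\<^sub>-\<^sub>1\<parallel>\<close>, and this makes
  \<open>\<parallel>v\<^sub>k\<^sub>+\<^sub>1 - u*\<parallel>\<^sup>2 + a\<^sup>2 \<parallel>g\<^sub>k - g\<^sub>k\<^sub>-\<^sub>1\<parallel>\<^sup>2\<close> decrease by at least \<open>a \<gamma> (a - \<rho>) \<parallel>g\<^sub>k\<parallel>\<^sup>2\<close> in each step.
\<close>

text \<open>Used with \<open>x\<close>, \<open>g\<close>, \<open>h\<close> as three consecutive
  values of \<open>F\<close>. Multiplied by \<open>c\<close>, the difference of the two sides equals
  the nonpositive slack in the squared hypothesis minus \<open>\<gamma>\<close> times a sum of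
  squares.\<close>

lemma correction_bound:
  fixes x g h :: "'a :: real_inner" and c \<gamma> :: real
  assumes "0 < \<gamma>" "0 < c" and c: "c * (1 + \<gamma>) = 1 - \<gamma>"
    and x: "norm (x - g) \<le> c * norm ((1 + \<gamma>) *\<^sub>R g - h)"
  shows "\<gamma>\<^sup>2 * (norm x)\<^sup>2 + (1 + \<gamma>) * (norm (x - g))\<^sup>2 - \<gamma> * (norm g)\<^sup>2 \<le> (norm (g - h))\<^sup>2"
proof -
  define d e where "d = g - h" and "e = x - g"
  have g: "g = h + d" and x': "x = h + d + e" by (simp_all add: d_def e_def)
  have "(norm e)\<^sup>2 \<le> (c * norm ((1 + \<gamma>) *\<^sub>R g - h))\<^sup>2"
    using x by (intro power_mono) (simp_all add: e_def)
  moreover have "c * (\<gamma>\<^sup>2 * (norm x)\<^sup>2 + (1 + \<gamma>) * (norm e)\<^sup>2 - \<gamma> * (norm g)\<^sup>2 - (norm d)\<^sup>2)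
    = (norm e)\<^sup>2 - (c * norm ((1 + \<gamma>) *\<^sub>R g - h))\<^sup>2
      - \<gamma> * ((norm (c *\<^sub>R h - \<gamma> *\<^sub>R e))\<^sup>2 + c * (norm (d - \<gamma> *\<^sub>R e))\<^sup>2 + c * (1 + \<gamma>) * (norm e)\<^sup>2)"
  proof -
    \<comment> \<open>In these six inner products of \<open>h\<close>, \<open>d\<close>,
      \<open>e\<close> the claim becomes a polynomial identity modulo
      \<open>c * (1 + \<gamma>) = 1 - \<gamma>\<close>.\<close>
    define H D E hd he de where "H = h \<bullet> h" and "D = d \<bullet> d" and "E = e \<bullet> e"
      and "hd = h \<bullet> d" and "he = h \<bullet> e" and "de = d \<bullet> e"
    have "(1 + \<gamma>) *\<^sub>R g - h = \<gamma> *\<^sub>R h + (1 + \<gamma>) *\<^sub>R d"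
      by (simp add: g algebra_simps)
    then have n: "(norm ((1 + \<gamma>) *\<^sub>R g - h))\<^sup>2 = \<gamma>\<^sup>2 * H + 2 * \<gamma> * (1 + \<gamma>) * hd + (1 + \<gamma>)\<^sup>2 * D"
      by (simp only: power2_norm_eq_inner)
        (simp add: inner_add inner_commute H_def D_def hd_def algebra_simps power2_eq_square)
    have nx: "(norm x)\<^sup>2 = H + D + E + 2 * hd + 2 * he + 2 * de"
      unfolding power2_norm_eq_inner x'
      by (simp add: inner_add inner_commute H_def D_def E_def hd_def he_def de_def)
    have ng: "(norm g)\<^sup>2 = H + D + 2 * hd"
      unfolding power2_norm_eq_inner g
      by (simp add: inner_add inner_commute H_def D_def hd_def)
    have n1: "(norm (c *\<^sub>R h - \<gamma> *\<^sub>R e))\<^sup>2 = c\<^sup>2 * H - 2 * c * \<gamma> * he + \<gamma>\<^sup>2 * E"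
      unfolding power2_norm_eq_inner
      by (simp add: inner_diff inner_commute H_def E_def he_def algebra_simps power2_eq_square)
    have n2: "(norm (d - \<gamma> *\<^sub>R e))\<^sup>2 = D - 2 * \<gamma> * de + \<gamma>\<^sup>2 * E"
      unfolding power2_norm_eq_inner
      by (simp add: inner_diff inner_commute D_def E_def de_def algebra_simps power2_eq_square)
    have ne: "(norm e)\<^sup>2 = E" "(norm d)\<^sup>2 = D"
      by (simp_all add: power2_norm_eq_inner E_def D_def)
    show ?thesis
      using c unfolding power_mult_distrib n nx ng n1 n2 ne by algebra
  qed
  moreover have "0 \<le> \<gamma> * ((norm (c *\<^sub>R h - \<gamma> *\<^sub>R e))\<^sup>2 + c * (norm (d - \<gamma> *\<^sub>R e))\<^sup>2 + c * (1 + \<gamma>) * (norm e)\<^sup>2)"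
    using assms(1,2) by simp
  ultimately have "c * (\<gamma>\<^sup>2 * (norm x)\<^sup>2 + (1 + \<gamma>) * (norm e)\<^sup>2 - \<gamma> * (norm g)\<^sup>2 - (norm d)\<^sup>2) \<le> 0"
    by linarith
  then show ?thesis
    using \<open>0 < c\<close> by (simp add: mult_le_0_iff d_def e_def)
qed

text \<open>The weak Minty inequality bounds the part of the cross term along
  \<open>u - ustar\<close>; polarization rewrites the remaining
  \<open>-2 * (F u \<bullet> h)\<close> as \<open>(norm (F u - h))\<^sup>2 - (norm (F u))\<^sup>2 -
  (norm h)\<^sup>2\<close>. The vector \<open>h\<close> stands for the previous value of
  \<open>F\<close>.\<close>

lemma weak_minty_step:
  assumes "weak_minty_solution F \<rho> ustar" "0 < \<gamma>" "0 < a"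
    and step: "u' = u - a *\<^sub>R ((1 + \<gamma>) *\<^sub>R F u - h)"
  shows "(norm (u' + a *\<^sub>R F u - ustar))\<^sup>2 \<le> (norm (u + a *\<^sub>R h - ustar))\<^sup>2
    + a * \<gamma> * (\<rho> - a + a * \<gamma>) * (norm (F u))\<^sup>2
    + a\<^sup>2 * \<gamma> * ((norm (F u - h))\<^sup>2 - (norm h)\<^sup>2)"
proof -
  define w g where "w = u - ustar" and "g = F u"
  have "- (\<rho> / 2) * (norm g)\<^sup>2 \<le> g \<bullet> w"
    using assms(1) by (simp add: weak_minty_solution_def w_def g_def)
  then have minty: "2 * a * \<gamma> * (- (\<rho> / 2) * (norm g)\<^sup>2) \<le> 2 * a * \<gamma> * (g \<bullet> w)"
    using assms(2,3) by (intro mult_left_mono) auto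
  have v: "u' + a *\<^sub>R F u - ustar = (w + a *\<^sub>R h) - (a * \<gamma>) *\<^sub>R g"
    "u + a *\<^sub>R h - ustar = w + a *\<^sub>R h"
    by (simp_all add: step w_def g_def algebra_simps)
  show ?thesis
    using minty unfolding v unfolding g_def[symmetric] power2_norm_eq_inner
    by (simp add: inner_add inner_diff inner_commute algebra_simps power2_eq_square)
qed

text \<open>Telescoped energy decrease. The squared difference of consecutive values of
  \<open>F\<close> is carried along because the next step consumes it.\<close>

lemma ogda_plus_energy:
  fixes F :: "real ^ 'd \<Rightarrow> real ^ 'd" and u0 :: "real ^ 'd"
  assumes "0 < L" "L-lipschitz_on UNIV F" "weak_minty_solution F \<rho> ustar"
    and "0 < \<gamma>" "\<gamma> \<le> 1" "0 < a" and aL: "a * L \<le> (1 - \<gamma>) / (1 + \<gamma>)"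
  defines "u \<equiv> ogda_plus F a \<gamma> u0"
  shows "(norm (u (Suc k) + a *\<^sub>R F (u k) - ustar))\<^sup>2 + a\<^sup>2 * (norm (F (u k) - F (u (k - 1))))\<^sup>2
    + a * \<gamma> * (a - \<rho>) * (\<Sum>i\<le>k. (norm (F (u i)))\<^sup>2) \<le> (norm (u0 + a *\<^sub>R F u0 - ustar))\<^sup>2"
proof (induction k)
  case 0
  \<comment> \<open>As the index before \<open>0\<close> is again \<open>0\<close>, here
    \<open>h = F (u 0)\<close> and the difference term vanishes.\<close>
  have "u (Suc 0) = u 0 - a *\<^sub>R ((1 + \<gamma>) *\<^sub>R F (u 0) - F (u 0))" "u 0 = u0"
    by (simp_all add: u_def)
  from weak_minty_step[OF assms(3,4,6) this(1)] this(2)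
  have "(norm (u (Suc 0) + a *\<^sub>R F (u 0) - ustar))\<^sup>2 + a * \<gamma> * (a - \<rho>) * (norm (F (u 0)))\<^sup>2
    \<le> (norm (u0 + a *\<^sub>R F u0 - ustar))\<^sup>2 + a\<^sup>2 * \<gamma> * (\<gamma> - 1) * (norm (F (u 0)))\<^sup>2"
    by (simp add: algebra_simps power2_eq_square)
  moreover have "a\<^sup>2 * \<gamma> * (\<gamma> - 1) * (norm (F (u 0)))\<^sup>2 \<le> 0"
    using assms(4,5) by (intro mult_nonpos_nonneg mult_nonneg_nonpos) auto
  ultimately show ?case by simp
next
  case (Suc k)
  define c where "c = (1 - \<gamma>) / (1 + \<gamma>)"
  define g g' h where "g = F (u k)" and "g' = F (u (Suc k))" and "h = F (u (k - 1))"
  \<comment> \<open>Positivity of \<open>a * L\<close> excludes \<open>\<gamma> = 1\<close>. Below,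
    \<open>a * L\<close> is enlarged to \<open>c\<close>, for which
    \<open>c * (1 + \<gamma>) = 1 - \<gamma>\<close> holds exactly.\<close>
  have "0 < a * L" using assms(1,6) by simp
  then have "0 < c" using aL by (simp add: c_def)
  have c: "c * (1 + \<gamma>) = 1 - \<gamma>" using assms(4) by (simp add: c_def)
  have "u (Suc k) - u k = - (a *\<^sub>R ((1 + \<gamma>) *\<^sub>R g - h))"
    by (simp add: u_def g_def h_def)
  then have "norm (g' - g) \<le> (a * L) * norm ((1 + \<gamma>) *\<^sub>R g - h)"
    using lipschitz_onD[OF assms(2), of "u (Suc k)" "u k"] assms(6)
    by (simp add: g'_def g_def dist_norm mult_ac)
  also have "\<dots> \<le> c * norm ((1 + \<gamma>) *\<^sub>R g - h)"
    using aL by (intro mult_right_mono) (simp_all add: c_def)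
  finally have "\<gamma>\<^sup>2 * (norm g')\<^sup>2 + (1 + \<gamma>) * (norm (g' - g))\<^sup>2 - \<gamma> * (norm g)\<^sup>2 \<le> (norm (g - h))\<^sup>2"
    by (rule correction_bound[OF assms(4) \<open>0 < c\<close> c])
  \<comment> \<open>Scaled by \<open>a\<^sup>2\<close>, the left side is exactly the excess that
    \<open>weak_minty_step\<close> leaves over the desired decrease.\<close>
  then have "a\<^sup>2 * (\<gamma>\<^sup>2 * (norm g')\<^sup>2 + (1 + \<gamma>) * (norm (g' - g))\<^sup>2 - \<gamma> * (norm g)\<^sup>2) \<le> a\<^sup>2 * (norm (g - h))\<^sup>2"
    by (intro mult_left_mono) auto
  moreover have "u (Suc (Suc k)) = u (Suc k) - a *\<^sub>R ((1 + \<gamma>) *\<^sub>R F (u (Suc k)) - g)"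
    by (simp add: u_def g_def)
  note weak_minty_step[OF assms(3,4,6) this]
  ultimately show ?case
    using Suc.IH unfolding g_def[symmetric] h_def[symmetric] g'_def[symmetric]
    by (simp add: g_def[symmetric] g'_def[symmetric] algebra_simps power2_eq_square)
qed

lemma ogda_plus_min_bound:
  fixes F :: "real ^ 'd \<Rightarrow> real ^ 'd"
  assumes "0 < L" "L-lipschitz_on UNIV F" "weak_minty_solution F \<rho> ustar"
    and "0 < \<gamma>" "\<gamma> \<le> 1" "0 < a" "\<rho> < a" "a * L \<le> (1 - \<gamma>) / (1 + \<gamma>)" "k \<ge> 1"
  shows "(MIN i\<in>{0..k-1}. (norm (F (ogda_plus F a \<gamma> u0 i)))\<^sup>2)
    \<le> 1 / (real k * a * \<gamma> * (a - \<rho>)) * (norm (u0 + a *\<^sub>R F u0 - ustar))\<^sup>2"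
proof -
  define G where "G i = (norm (F (ogda_plus F a \<gamma> u0 i)))\<^sup>2" for i
  define m where "m = (MIN i\<in>{0..k-1}. G i)"
  \<comment> \<open>Since \<open>k \<ge> 1\<close>, the index set \<open>{..k-1}\<close> has exactly
    \<open>k\<close> elements.\<close>
  have "real k * m = (\<Sum>i\<le>k-1. m)" using assms(9) by simp
  also have "\<dots> \<le> (\<Sum>i\<le>k-1. G i)"
    unfolding m_def by (intro sum_mono Min_le) auto
  finally have "a * \<gamma> * (a - \<rho>) * (real k * m) \<le> a * \<gamma> * (a - \<rho>) * (\<Sum>i\<le>k-1. G i)"
    using assms(4,6,7) by (intro mult_left_mono) auto
  \<comment> \<open>The two squares in the energy are nonnegative and are dropped.\<close>
  also have "\<dots> \<le> (norm (u0 + a *\<^sub>R F u0 - ustar))\<^sup>2"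
    using ogda_plus_energy[OF assms(1-6,8), of u0 "k - 1"] unfolding G_def
    by (smt (verit) zero_le_power2 mult_nonneg_nonneg)
  finally have "m * (real k * a * \<gamma> * (a - \<rho>)) \<le> (norm (u0 + a *\<^sub>R F u0 - ustar))\<^sup>2"
    by (simp add: mult_ac)
  moreover have "0 < real k * a * \<gamma> * (a - \<rho>)" using assms(4,6,7,9) by simp
  ultimately show ?thesis
    by (simp add: m_def G_def pos_le_divide_eq)
qed

theorem theorem3p1:
  fixes F :: "real ^ 'd \<Rightarrow> real ^ 'd" and L \<rho> :: real and ustar :: "real ^ 'd"
  assumes "L > 0" and "L-lipschitz_on UNIV F"
    and "\<rho> > 0" and "weak_minty_solution F \<rho> ustar"
    and "\<rho> < 1 / L"
  shows "(\<forall>(u0 :: real ^ 'd) (\<gamma> :: real) (a :: real).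
           0 < \<gamma> \<and> \<gamma> \<le> 1 \<and> 0 < a \<and> \<rho> < a \<and> a * L \<le> (1 - \<gamma>) / (1 + \<gamma>) \<longrightarrow>
           (\<forall>k::nat. k \<ge> 1 \<longrightarrow>
              (MIN i\<in>{0..k-1}. (norm (F (ogda_plus F a \<gamma> u0 i)))\<^sup>2)
                \<le> 1 / (real k * a * \<gamma> * (a - \<rho>)) * (norm (u0 + a *\<^sub>R F u0 - ustar))\<^sup>2))
       \<and> (\<exists>\<gamma>0 :: real. 0 < \<gamma>0 \<and> \<gamma>0 \<le> 1 \<and>
           (\<forall>\<gamma> :: real. 0 < \<gamma> \<and> \<gamma> \<le> \<gamma>0 \<longrightarrow>
             (\<exists>a :: real. 0 < a \<and> \<rho> < a \<and> a * L \<le> (1 - \<gamma>) / (1 + \<gamma>) \<and>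
               (\<forall>(u0 :: real ^ 'd) (k :: nat). k \<ge> 1 \<longrightarrow>
                  (MIN i\<in>{0..k-1}. (norm (F (ogda_plus F a \<gamma> u0 i)))\<^sup>2)
                    \<le> 1 / (real k * a * \<gamma> * (a - \<rho>)) * (norm (u0 + a *\<^sub>R F u0 - ustar))\<^sup>2))))"
proof (intro conjI allI impI)
  fix u0 :: "real ^ 'd" and \<gamma> a :: real and k :: nat
  assume "0 < \<gamma> \<and> \<gamma> \<le> 1 \<and> 0 < a \<and> \<rho> < a \<and> a * L \<le> (1 - \<gamma>) / (1 + \<gamma>)" "1 \<le> k"
  then show "(MIN i\<in>{0..k-1}. (norm (F (ogda_plus F a \<gamma> u0 i)))\<^sup>2)
      \<le> 1 / (real k * a * \<gamma> * (a - \<rho>)) * (norm (u0 + a *\<^sub>R F u0 - ustar))\<^sup>2"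
    by (intro ogda_plus_min_bound[OF assms(1,2,4)]) auto
next
  define s where "s = \<rho> * L"
  have s: "0 < s" "s < 1" using assms(1,3,5) by (simp_all add: s_def field_simps)
  \<comment> \<open>The condition \<open>s < (1 - \<gamma>) / (1 + \<gamma>)\<close> means
    \<open>\<gamma> < (1 - s) / (1 + s)\<close>; half of that threshold keeps the inequality
    strict.\<close>
  define \<gamma>0 where "\<gamma>0 = (1 - s) / (2 * (1 + s))"
  have \<gamma>0: "0 < \<gamma>0" "\<gamma>0 \<le> 1" using s by (simp_all add: \<gamma>0_def field_simps)
  show "\<exists>\<gamma>0 :: real. 0 < \<gamma>0 \<and> \<gamma>0 \<le> 1 \<and>
           (\<forall>\<gamma> :: real. 0 < \<gamma> \<and> \<gamma> \<le> \<gamma>0 \<longrightarrow>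
             (\<exists>a :: real. 0 < a \<and> \<rho> < a \<and> a * L \<le> (1 - \<gamma>) / (1 + \<gamma>) \<and>
               (\<forall>(u0 :: real ^ 'd) (k :: nat). k \<ge> 1 \<longrightarrow>
                  (MIN i\<in>{0..k-1}. (norm (F (ogda_plus F a \<gamma> u0 i)))\<^sup>2)
                    \<le> 1 / (real k * a * \<gamma> * (a - \<rho>)) * (norm (u0 + a *\<^sub>R F u0 - ustar))\<^sup>2)))"
  proof (rule exI[of _ \<gamma>0], intro conjI \<gamma>0 allI impI)
    fix \<gamma> assume \<gamma>: "0 < \<gamma> \<and> \<gamma> \<le> \<gamma>0"
    \<comment> \<open>The largest step size allowed for this \<open>\<gamma>\<close>.\<close>
    define a where "a = (1 - \<gamma>) / (1 + \<gamma>) / L"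
    have aL: "a * L = (1 - \<gamma>) / (1 + \<gamma>)" using assms(1) by (simp add: a_def)
    have "\<gamma> * (2 * (1 + s)) \<le> 1 - s" using \<gamma> s by (simp add: \<gamma>0_def field_simps)
    moreover have "0 < \<gamma> * (1 + s)" using \<gamma> s by simp
    ultimately have "s * (1 + \<gamma>) < 1 - \<gamma>" by (simp add: algebra_simps)
    then have "s < a * L" unfolding aL using \<gamma> by (simp add: pos_less_divide_eq)
    then have a: "\<rho> < a" using assms(1) by (simp add: s_def)
    show "\<exists>a>0. \<rho> < a \<and> a * L \<le> (1 - \<gamma>) / (1 + \<gamma>) \<and>
               (\<forall>(u0 :: real ^ 'd) (k :: nat). k \<ge> 1 \<longrightarrow>
                  (MIN i\<in>{0..k-1}. (norm (F (ogda_plus F a \<gamma> u0 i)))\<^sup>2)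
                    \<le> 1 / (real k * a * \<gamma> * (a - \<rho>)) * (norm (u0 + a *\<^sub>R F u0 - ustar))\<^sup>2)"
    proof (intro exI[of _ a] conjI allI impI)
      fix u0 :: "real ^ 'd" and k :: nat
      assume "1 \<le> k"
      then show "(MIN i\<in>{0..k-1}. (norm (F (ogda_plus F a \<gamma> u0 i)))\<^sup>2)
          \<le> 1 / (real k * a * \<gamma> * (a - \<rho>)) * (norm (u0 + a *\<^sub>R F u0 - ustar))\<^sup>2"
        using assms(3) a aL \<gamma> \<gamma>0 by (intro ogda_plus_min_bound[OF assms(1,2,4)]) auto
    qed (use a aL assms(3) in auto)
  qed
qed

end
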